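(* Let $G$ be a connected finite graph and let $H$ be a graph such that $|V(G)|=|V(H)|$. Then $h_H(G)=|E(H)|$ if and only if $H$ is isomorphic to some subgraph of $G$.
   Context: All graphs are finite, simple and undirected. For a connected graph $G$, $\rho_G(x,y)$ denotes the graph distance of vertices $x,y$ in $G$. Given graphs $G,H$ with $|V(G)|=|V(H)|$, a pseudoordering on $G$ by $H$ is a bijection $f:V(H)\to V(G)$, and its sum is $$s_H(f,G)=\sum_{\{x,y\}\in E(H)}\rho_G(f(x),f(y)).$$ The lower $H$-Hamiltonian number of $G$ is $h_H(G)=\min\{s_H(f,G)\mid f \text{ a pseudoordering on } G \text{ by } H\}$. Subgraphs are not required to be induced. *)

theory Defs
  imports "Graph_Theory.Graph_Theory"
begin

text \<open>
  Finite simple undirected graphs are rendered by the locale predicate \<^const>\<open>graph\<close>: finite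
  digraphs without loops and parallel arcs whose adjacency relation is symmetric. An undirected
  edge \<open>{u, v}\<close> is thus represented by the two arcs from \<open>u\<close> to \<open>v\<close> and from \<open>v\<close> to \<open>u\<close>, so that
  the edge set \<open>E(G)\<close> is the following set of vertex pairs, and not \<^term>\<open>arcs G\<close>.
\<close>

definition uedges :: "('a, 'b) pre_digraph \<Rightarrow> 'a set set" where
  "uedges G = {{u, v} | u v. u \<rightarrow>\<^bsub>G\<^esub> v}"

text \<open>
  The distance is a natural number; its value is only meaningful if \<open>v\<close> is reachable from \<open>u\<close>.
\<close>

definition gdist :: "('a, 'b) pre_digraph \<Rightarrow> 'a \<Rightarrow> 'a \<Rightarrow> nat" where
  "gdist G u v = (LEAST n. \<exists>p. pre_digraph.awalk G u p v \<and> length p = n)"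

definition pseudoordering ::
    "('c, 'd) pre_digraph \<Rightarrow> ('a, 'b) pre_digraph \<Rightarrow> ('c \<Rightarrow> 'a) \<Rightarrow> bool" where
  "pseudoordering H G f \<longleftrightarrow> bij_betw f (verts H) (verts G)"

text \<open>
  The summand \<open>\<rho>(f x, f y)\<close> belonging to an unordered edge \<open>e = {x, y}\<close> is the element of a set which
  is a singleton because the distance is symmetric (see \<open>edge_summand\<close> below).
\<close>

definition pseudo_sum ::
    "('c, 'd) pre_digraph \<Rightarrow> ('c \<Rightarrow> 'a) \<Rightarrow> ('a, 'b) pre_digraph \<Rightarrow> nat" where
  "pseudo_sum H f G = (\<Sum>e\<in>uedges H. the_elem {gdist G (f x) (f y) | x y. e = {x, y}})"

definition lower_hamiltonian_number ::
    "('c, 'd) pre_digraph \<Rightarrow> ('a, 'b) pre_digraph \<Rightarrow> nat" where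
  "lower_hamiltonian_number H G = Min {pseudo_sum H f G | f. pseudoordering H G f}"


lemma gdist_eq_shortest_path:
  assumes "wf_digraph G" and "u \<rightarrow>\<^sup>*\<^bsub>G\<^esub> v"
  shows "ereal (real (gdist G u v)) = wf_digraph.\<mu> G (\<lambda>_. 1) u v"
proof -
  interpret wf_digraph G by fact
  have cost: "awalk_cost (\<lambda>_. 1) p = real (length p)" for p :: "'b list"
    by (induction p) auto
  obtain q where "awalk u q v"
    using assms(2) by (auto simp: reachable_awalk)
  then have "\<exists>p. awalk u p v \<and> length p = gdist G u v"
    unfolding gdist_def
    using LeastI[of "\<lambda>n. \<exists>p. awalk u p v \<and> length p = n" "length q"] by blast
  then obtain p where p: "awalk u p v" "length p = gdist G u v"
    by blast
  have "gdist G u v \<le> length r" if "awalk u r v" for r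
    unfolding gdist_def using that by (auto intro: Least_le)
  with p show ?thesis
    unfolding \<mu>_def cost by (intro antisym INF_greatest) (auto intro: INF_lower2)
qed

lemma gdist_commute:
  assumes "graph G"
  shows "gdist G u v = gdist G v u"
proof -
  interpret graph G by fact
  have rev: "\<exists>q. awalk y q x \<and> length q = length p" if "awalk x p y" for x p y
    using that
  proof (induction p arbitrary: x)
    case Nil
    then show ?case by (auto simp: awalk_Nil_iff)
  next
    case (Cons e p)
    then obtain q where q: "awalk y q (head G e)" "length q = length p"
      by (auto simp: awalk_Cons_iff)
    from Cons.prems have "tail G e \<rightarrow>\<^bsub>G\<^esub> head G e" and x: "x = tail G e"
      by (auto simp: awalk_Cons_iff arcs_ends_conv)
    then have "head G e \<rightarrow>\<^bsub>G\<^esub> x"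
      using symmetric_conv by (auto intro: arcs_ends_symmetric)
    then obtain e' where "e' \<in> arcs G" "tail G e' = head G e" "head G e' = x"
      by (auto simp: arcs_ends_conv)
    then have "awalk (head G e) [e'] x"
      by (auto simp: awalk_Cons_iff awalk_Nil_iff)
    with q have "awalk y (q @ [e']) x" by auto
    with q show ?case by (intro exI[of _ "q @ [e']"]) auto
  qed
  show ?thesis
    unfolding gdist_def by (rule arg_cong[where f = Least]) (use rev in metis)
qed

lemma edge_summand:
  assumes "graph G"
  shows "the_elem {gdist G (f x) (f y) | x y. {a, b} = {x, y}} = gdist G (f a) (f b)"
proof -
  have "{gdist G (f x) (f y) | x y. {a, b} = {x, y}} = {gdist G (f a) (f b)}"
    using gdist_commute[OF assms] by (auto simp: doubleton_eq_iff)
  then show ?thesis by simp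
qed

text \<open>
  The minimum is over a finite set although there may be infinitely many functions \<open>f\<close>, since the
  sum depends only on the values of \<open>f\<close> on the vertices of \<open>H\<close>.
\<close>

lemma finite_pseudo_sums:
  assumes "graph G" and "graph H"
  shows "finite {pseudo_sum H f G | f. pseudoordering H G f}"
proof -
  interpret G: graph G by fact
  interpret H: graph H by fact
  have "pseudo_sum H f G = pseudo_sum H (restrict f (verts H)) G" for f
    unfolding pseudo_sum_def
  proof (rule sum.cong)
    fix e assume "e \<in> uedges H"
    then obtain a b where e: "e = {a, b}" "a \<in> verts H" "b \<in> verts H"
      unfolding uedges_def by (auto dest: H.adj_in_verts)
    then show "the_elem {gdist G (f x) (f y) | x y. e = {x, y}} =
        the_elem {gdist G (restrict f (verts H) x) (restrict f (verts H) y) | x y. e = {x, y}}"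
      by (simp only: e(1) edge_summand[OF assms(1)]) simp
  qed simp
  then have "{pseudo_sum H f G | f. pseudoordering H G f}
      \<subseteq> (\<lambda>f. pseudo_sum H f G) ` (verts H \<rightarrow>\<^sub>E verts G)"
    unfolding pseudoordering_def by (fastforce dest: bij_betwE)
  moreover have "finite (verts H \<rightarrow>\<^sub>E verts G)"
    by (intro finite_PiE) auto
  ultimately show ?thesis
    by (meson finite_imageI finite_subset)
qed

end

theory Submission
  imports Defs
begin

text \<open>
  Since \<open>G\<close> is connected, every distance between two of its vertices is the length of an actual
  walk. A pseudoordering is injective, so it sends the ends of an edge of \<open>H\<close> to distinct vertices
  of \<open>G\<close>, and each of the \<open>|E(H)|\<close> summands of its sum is at least 1. The sum is therefore at
  least \<open>|E(H)|\<close>, with equality exactly if all summands are 1, that is, if the pseudoordering sends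
  adjacent vertices to adjacent vertices (\<open>pseudo_sum_eq_card_iff\<close>). As the minimum is attained, the
  lower \<open>H\<close>-Hamiltonian number equals \<open>|E(H)|\<close> if and only if there is an adjacency-preserving
  bijection from the vertices of \<open>H\<close> to those of \<open>G\<close>.

  It remains to see that \<open>H\<close> is isomorphic to a subgraph of \<open>G\<close> if and only if there is an
  adjacency-preserving injection (\<open>iso_subgraph_iff_injection\<close>): the image of such a map,
  with the images of the edges of \<open>H\<close> as its edges, is a subgraph of \<open>G\<close>, and conversely an
  isomorphism onto a subgraph is such a map. As the two vertex sets have the same finite
  cardinality, every such injection is a bijection.
\<close>

lemma connected_graph_reachable:
  assumes "graph G" and "connected G" and "u \<in> verts G" and "v \<in> verts G"
  shows "u \<rightarrow>\<^sup>*\<^bsub>G\<^esub> v"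
proof -
  interpret graph G by fact
  show ?thesis
    using assms(2-4) sym_arcs
    by (auto simp: connected_def strongly_connected_def reachable_mk_symmetric_eq)
qed

lemma shortest_awalk:
  assumes "wf_digraph G" and "u \<rightarrow>\<^sup>*\<^bsub>G\<^esub> v"
  obtains p where "pre_digraph.awalk G u p v" and "length p = gdist G u v"
proof -
  interpret wf_digraph G by fact
  obtain q where "awalk u q v"
    using assms(2) by (auto simp: reachable_awalk)
  then have "\<exists>p. awalk u p v \<and> length p = gdist G u v"
    unfolding gdist_def
    using LeastI[of "\<lambda>n. \<exists>p. awalk u p v \<and> length p = n" "length q"] by blast
  then show thesis
    using that by blast
qed

text \<open>
  Reachability is essential here and in the next lemma: the least element of an empty set of walk
  lengths is an unspecified number, about which nothing can be said.
\<close>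

lemma gdist_pos:
  assumes "wf_digraph G" and "u \<rightarrow>\<^sup>*\<^bsub>G\<^esub> v" and "u \<noteq> v"
  shows "1 \<le> gdist G u v"
proof -
  interpret wf_digraph G by fact
  obtain p where p: "awalk u p v" "length p = gdist G u v"
    using shortest_awalk[OF assms(1,2)] .
  with assms(3) have "p \<noteq> []"
    by (auto simp: awalk_Nil_iff)
  with p(2) show ?thesis
    by (cases p) auto
qed

lemma gdist_eq_1_iff_adjacent:
  assumes "wf_digraph G" and "u \<rightarrow>\<^sup>*\<^bsub>G\<^esub> v" and "u \<noteq> v"
  shows "gdist G u v = 1 \<longleftrightarrow> u \<rightarrow>\<^bsub>G\<^esub> v"
proof -
  interpret wf_digraph G by fact
  show ?thesis
  proof
    assume one: "gdist G u v = 1"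
    obtain p where p: "awalk u p v" "length p = gdist G u v"
      using shortest_awalk[OF assms(1,2)] .
    with one obtain e where "p = [e]"
      by (auto simp: length_Suc_conv)
    with p(1) show "u \<rightarrow>\<^bsub>G\<^esub> v"
      by (auto simp: awalk_simps arcs_ends_conv)
  next
    assume "u \<rightarrow>\<^bsub>G\<^esub> v"
    then obtain e where "e \<in> arcs G" "tail G e = u" "head G e = v"
      by auto
    then have "awalk u [e] v"
      by (auto simp: awalk_simps)
    then have "gdist G u v \<le> 1"
      unfolding gdist_def by (intro Least_le) (auto intro: exI[of _ "[e]"])
    with gdist_pos[OF assms] show "gdist G u v = 1"
      by simp
  qed
qed

lemma finite_uedges:
  assumes "fin_digraph H"
  shows "finite (uedges H)"
proof -
  interpret fin_digraph H by fact
  have "uedges H \<subseteq> Pow (verts H)"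
    unfolding uedges_def by (auto dest: adj_in_verts)
  then show ?thesis
    by (rule finite_subset) simp
qed

lemma edge_images_distinct_reachable:
  assumes "graph G" and "connected G" and "graph H" and "pseudoordering H G f"
    and "x \<rightarrow>\<^bsub>H\<^esub> y"
  shows "f x \<noteq> f y" and "f x \<rightarrow>\<^sup>*\<^bsub>G\<^esub> f y"
proof -
  interpret H: graph H by fact
  have xy: "x \<in> verts H" "y \<in> verts H" "x \<noteq> y"
    using assms(5) H.adj_in_verts H.adj_not_same by auto
  have bij: "bij_betw f (verts H) (verts G)"
    using assms(4) by (simp add: pseudoordering_def)
  then show "f x \<noteq> f y"
    using xy by (auto simp: bij_betw_def dest: inj_onD)
  show "f x \<rightarrow>\<^sup>*\<^bsub>G\<^esub> f y"
    using bij xy by (intro connected_graph_reachable assms(1,2)) (auto dest: bij_betwE)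
qed

lemma summand_pos:
  assumes "graph G" and "connected G" and "graph H" and "pseudoordering H G f"
    and "e \<in> uedges H"
  shows "1 \<le> the_elem {gdist G (f x) (f y) | x y. e = {x, y}}"
proof -
  interpret graph G by fact
  obtain a b where "e = {a, b}" "a \<rightarrow>\<^bsub>H\<^esub> b"
    using assms(5) by (auto simp: uedges_def)
  with edge_images_distinct_reachable[OF assms(1-4)] show ?thesis
    by (simp only: edge_summand[OF assms(1)]) (intro gdist_pos wf_digraph)
qed

lemma card_uedges_le_pseudo_sum:
  assumes "graph G" and "connected G" and "graph H" and "pseudoordering H G f"
  shows "card (uedges H) \<le> pseudo_sum H f G"
  unfolding pseudo_sum_def card_eq_sum by (intro sum_mono summand_pos[OF assms])

text \<open>
  A sum of terms that are at least 1 equals the number of its terms only if each of them is 1.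
\<close>

lemma pseudo_sum_eq_card_iff:
  assumes "graph G" and "connected G" and "graph H" and "pseudoordering H G f"
  shows "pseudo_sum H f G = card (uedges H) \<longleftrightarrow>
    (\<forall>x y. x \<rightarrow>\<^bsub>H\<^esub> y \<longrightarrow> f x \<rightarrow>\<^bsub>G\<^esub> f y)"
proof -
  interpret G: graph G by fact
  interpret H: graph H by fact
  let ?s = "\<lambda>e. the_elem {gdist G (f x) (f y) | x y. e = {x, y}}"
  have "pseudo_sum H f G = card (uedges H) \<longleftrightarrow> (\<forall>e\<in>uedges H. ?s e = 1)"
  proof
    assume "pseudo_sum H f G = card (uedges H)"
    then have eq: "(\<Sum>e\<in>uedges H. 1) = sum ?s (uedges H)"
      by (simp add: pseudo_sum_def)
    show "\<forall>e\<in>uedges H. ?s e = 1"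
    proof
      fix e assume "e \<in> uedges H"
      from sum_mono_inv[OF eq summand_pos[OF assms] this finite_uedges[OF H.fin_digraph]]
      show "?s e = 1" by (rule sym)
    qed
  qed (simp add: pseudo_sum_def)
  also have "\<dots> \<longleftrightarrow> (\<forall>x y. x \<rightarrow>\<^bsub>H\<^esub> y \<longrightarrow> ?s {x, y} = 1)"
    unfolding uedges_def by blast
  also have "\<dots> \<longleftrightarrow> (\<forall>x y. x \<rightarrow>\<^bsub>H\<^esub> y \<longrightarrow> f x \<rightarrow>\<^bsub>G\<^esub> f y)"
    unfolding edge_summand[OF assms(1)]
    using gdist_eq_1_iff_adjacent[OF G.wf_digraph]
      edge_images_distinct_reachable[OF assms] by blast
  finally show ?thesis .
qed

text \<open>
  The minimum is attained: it is taken over a finite set, which is nonempty because finite vertex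
  sets of the same cardinality are in bijection.
\<close>

lemma lower_hamiltonian_number_eq_card_iff:
  assumes "graph G" and "connected G" and "graph H"
    and "card (verts G) = card (verts H)"
  shows "lower_hamiltonian_number H G = card (uedges H) \<longleftrightarrow>
    (\<exists>f. pseudoordering H G f \<and> pseudo_sum H f G = card (uedges H))"
proof -
  interpret G: graph G by fact
  interpret H: graph H by fact
  obtain f where "pseudoordering H G f"
    using finite_same_card_bij[OF H.finite_verts G.finite_verts] assms(4)
    by (auto simp: pseudoordering_def)
  let ?S = "{pseudo_sum H f G | f. pseudoordering H G f}"
  have "?S \<noteq> {}"
    using \<open>pseudoordering H G f\<close> by blast
  moreover have "card (uedges H) \<le> s" if "s \<in> ?S" for s
    using that card_uedges_le_pseudo_sum[OF assms(1-3)] by blast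
  ultimately have "Min ?S = card (uedges H) \<longleftrightarrow> card (uedges H) \<in> ?S"
    using Min_eq_iff[OF finite_pseudo_sums[OF assms(1,3)]] by blast
  also have "\<dots> \<longleftrightarrow> (\<exists>f. pseudoordering H G f \<and> pseudo_sum H f G = card (uedges H))"
    by (auto intro: sym)
  finally show ?thesis
    unfolding lower_hamiltonian_number_def .
qed

text \<open>
  An isomorphism of digraphs maps arcs as well as vertices, so an adjacency-preserving injection \<open>f\<close>
  has to be completed by an arc map: an arc of \<open>H\<close> goes to some arc of \<open>G\<close> between the images of its
  ends. Injectivity of the arc map holds because \<open>f\<close> is injective and \<open>H\<close> has no parallel arcs. The
  image is closed under reversal of arcs, hence again an undirected graph, because \<open>H\<close> is.
\<close>

lemma iso_subgraph_iff_injection: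
  assumes "graph G" and "graph H"
  shows "(\<exists>K. graph K \<and> subgraph K G \<and> digraph_iso H K) \<longleftrightarrow>
    (\<exists>f. inj_on f (verts H) \<and> f ` verts H \<subseteq> verts G \<and>
      (\<forall>x y. x \<rightarrow>\<^bsub>H\<^esub> y \<longrightarrow> f x \<rightarrow>\<^bsub>G\<^esub> f y))"
    (is "?subgraph \<longleftrightarrow> ?injection")
proof -
  interpret G: graph G by fact
  interpret H: graph H by fact
  show ?thesis
  proof
    assume ?subgraph
    then obtain K h where K: "subgraph K G" "H.digraph_isomorphism h" "K = app_iso h H"
      by (auto simp: digraph_iso_def)
    have "iso_verts h x \<rightarrow>\<^bsub>G\<^esub> iso_verts h y" if "x \<rightarrow>\<^bsub>H\<^esub> y" for x y
    proof -
      have "iso_verts h x \<rightarrow>\<^bsub>K\<^esub> iso_verts h y"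
        unfolding K(3) H.arcs_ends_app_iso_eq[OF K(2)] using that by force
      then show ?thesis
        using K(1) by (rule G.adj_mono)
    qed
    moreover have "iso_verts h ` verts H \<subseteq> verts G"
      using subgraph_imp_subverts[OF K(1)] by (simp add: K(3))
    ultimately show ?injection
      using H.digraph_isomorphism_inj_on_verts[OF K(2)] by blast
  next
    assume ?injection
    then obtain f where inj: "inj_on f (verts H)" and into: "f ` verts H \<subseteq> verts G"
      and adj: "\<And>x y. x \<rightarrow>\<^bsub>H\<^esub> y \<Longrightarrow> f x \<rightarrow>\<^bsub>G\<^esub> f y"
      by blast
    have "\<exists>b\<in>arcs G. tail G b = f (tail H a) \<and> head G b = f (head H a)" if "a \<in> arcs H" for a
      using adj[of "tail H a" "head H a"] that by (auto simp: arcs_ends_conv)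
    then obtain g where g: "g a \<in> arcs G" "tail G (g a) = f (tail H a)"
        "head G (g a) = f (head H a)" if "a \<in> arcs H" for a
      by metis
    \<comment> \<open>The end functions are those of \<open>G\<close>, as a subgraph must agree with \<open>G\<close> on them, even outside
      its own arcs.\<close>
    define h where "h = \<lparr>iso_verts = f, iso_arcs = g, iso_head = head G, iso_tail = tail G\<rparr>"
    have "inj_on g (arcs H)"
    proof (rule inj_onI)
      fix a b assume ab: "a \<in> arcs H" "b \<in> arcs H" "g a = g b"
      then have "f (tail H a) = f (tail H b)" "f (head H a) = f (head H b)"
        using g by metis+
      with ab inj show "a = b"
        by (intro H.no_multi_arcs) (auto simp: arc_to_ends_def dest: inj_onD)
    qed
    with inj g have iso: "H.digraph_isomorphism h"
      by (auto simp: H.digraph_isomorphism_def h_def H.wf_digraph)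
    let ?K = "app_iso h H"
    have sub: "subgraph ?K G"
      using into g G.wf_digraph H.wf_digraphI_app_iso[OF iso]
      by (auto simp: subgraph_def compatible_def h_def)
    have "symmetric ?K"
      unfolding symmetric_def H.arcs_ends_app_iso_eq[OF iso]
      using H.graph_symmetric by (force intro!: symI)
    then have "graph ?K"
      by (intro digraph.graphI G.digraph_subgraph sub)
    with sub iso show ?subgraph
      by (auto simp: digraph_iso_def)
  qed
qed

theorem lemma1p4:
  fixes G :: "('a, 'b) pre_digraph" and H :: "('c, 'd) pre_digraph"
  assumes "graph G" and "connected G" and "graph H"
    and "card (verts G) = card (verts H)"
  shows "lower_hamiltonian_number H G = card (uedges H) \<longleftrightarrow>
    (\<exists>K. graph K \<and> subgraph K G \<and> digraph_iso H K)"
proof -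
  interpret G: graph G by fact
  interpret H: graph H by fact
  \<comment> \<open>An injection between finite sets of the same cardinality is onto.\<close>
  have bij: "pseudoordering H G f \<longleftrightarrow> inj_on f (verts H) \<and> f ` verts H \<subseteq> verts G" for f
    using assms(4) card_image[of f "verts H"] card_subset_eq[OF G.finite_verts, of "f ` verts H"]
    by (auto simp: pseudoordering_def bij_betw_def)
  have "lower_hamiltonian_number H G = card (uedges H) \<longleftrightarrow>
      (\<exists>f. pseudoordering H G f \<and> (\<forall>x y. x \<rightarrow>\<^bsub>H\<^esub> y \<longrightarrow> f x \<rightarrow>\<^bsub>G\<^esub> f y))"
    using lower_hamiltonian_number_eq_card_iff[OF assms]
      pseudo_sum_eq_card_iff[OF assms(1-3)] by blast
  also have "\<dots> \<longleftrightarrow> (\<exists>K. graph K \<and> subgraph K G \<and> digraph_iso H K)"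
    unfolding iso_subgraph_iff_injection[OF assms(1,3)] bij by blast
  finally show ?thesis .
qed

end
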